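(* Let $\mathbf A$ be a finite Boolean algebra. Define on $\mathbb{T}(A)$ the relation $t\equiv s$ iff $X_t=X_s$ for every conditional probability $P$ on $A\times A'$ (where $X_t,X_s$ are the random quantities determined by $P$). Then $\equiv$ is an equivalence relation, the operations $[t]\wedge^*[s]=[t\wedge s]$, $[t]\vee^*[s]=[t\vee s]$, $\neg^*[t]=[\neg t]$ are well defined on $\mathbb{T}(A)/\!\equiv$, and with constants $0=[(\bot\mid\top)]$, $1=[(\top\mid\top)]$ the structure $\mathcal{T}(\mathbf A)=(\mathbb{T}(A)/\!\equiv,\wedge^*,\vee^*,\neg^*,0,1)$ is a Boolean algebra.
   Context: $\mathbf A=(A,\wedge,\vee,\neg,\bot,\top)$ is a finite Boolean algebra; write $ab$ for $a\wedge b$, $\bar a$ for $\neg a$, and $A'=A\setminus\{\bot\}$. $\Omega$ is the set of Boolean homomorphisms $w:\mathbf A\to\{0,1\}$ (identified with the atoms of $\mathbf A$); $w\models a$ means $w(a)=1$. A basic conditional is a pair $(a\mid b)$ with $a\in A$, $b\in A'$. $\mathbb{T}(A)$ is the set of terms built from basic conditionals (as variables) and constants $0,1$ using $\neg,\wedge,\vee$. For a term $t$, $\mathbf b(t)$ is the disjunction of the antecedents $b_i$ of the basic conditionals $(a_i\mid b_i)$ occurring in $t$ (and $\mathbf b(t)=\top$ if $t\in\{0,1\}$). For $w\in\Omega$ the $w$-reduct $t^w$ is obtained from $t$ by replacing each occurring $(a_i\mid b_i)$ by $1$ if $w\models a_ib_i$ and by $0$ if $w\models\bar a_ib_i$ (leaving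 it unchanged if $w\models\bar b_i$), and then applying to subterms the rules $\neg1:=0$, $\neg0:=1$, $r\wedge1=1\wedge r:=r$, $r\wedge0=0\wedge r:=0$, $r\vee1=1\vee r:=1$, $r\vee0=0\vee r:=r$ until no rule applies. A conditional probability on $A\times A'$ is a map $P:A\times A'\to[0,1]$ such that $P(\cdot\mid b)$ is a finitely additive probability on $\mathbf A$ for every $b\in A'$, $P(b\mid b)=1$, and $P(ab\mid c)=P(a\mid bc)P(b\mid c)$ for $a\in A$, $b,c\in A'$. For $X:\Omega\to\mathbb R$ and $b\in A'$, $\mathbb P(X\mid b)=\sum_{w\in\Omega}X(w)P(w\mid b)$ (with $w$ read as the corresponding atom). Given $P$, each term $t$ gets a random quantity $X_t:\Omega\to[0,1]$ defined recursively by $X_1\equiv1$, $X_0\equiv0$ and $X_t(w)=\mathbb P(X_{t^w}\mid\mathbf b(t^w))$; when $w\models\neg\mathbf b(t)$ one has $t^w=t$ and $X_t(w)$ is the value $\mathbb P(X_t\mid\mathbf b(t))$, which depends only on the values of $X_t$ at worlds $w\models\mathbf b(t)$ (where $t^w$ is a proper reduct). *)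

theory Defs
  imports Complex_Main
begin

text \<open>
  The finite Boolean algebra is a type of class \<open>{finite, boolean_algebra}\<close>; its meet, join,
  complement and bounds are \<open>inf\<close>, \<open>sup\<close>, \<open>uminus\<close>, \<open>bot\<close>, \<open>top\<close>.
\<close>

definition worlds :: "('a::boolean_algebra \<Rightarrow> bool) set" where
  "worlds = {w. \<not> w bot \<and> w top \<and> (\<forall>a b. w (inf a b) \<longleftrightarrow> w a \<and> w b)
                \<and> (\<forall>a b. w (sup a b) \<longleftrightarrow> w a \<or> w b) \<and> (\<forall>a. w (- a) \<longleftrightarrow> \<not> w a)}"

text \<open>The atom identified with a world is the least element that is true at it.\<close>

definition world_atom :: "('a::{finite,boolean_algebra} \<Rightarrow> bool) \<Rightarrow> 'a" where
  "world_atom w = Inf_fin {a. w a}"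

datatype 'a cterm =
    Zero
  | One
  | Cond 'a 'a
  | Neg "'a cterm"
  | Conj "'a cterm" "'a cterm"
  | Disj "'a cterm" "'a cterm"

text \<open>\<open>Cond a b\<close> is the pair \<open>(a | b)\<close>; it is a basic conditional only if \<open>b\<close> is not \<open>bot\<close>.\<close>

inductive_set cterms :: "'a::boolean_algebra cterm set" where
  "Zero \<in> cterms"
| "One \<in> cterms"
| "b \<noteq> bot \<Longrightarrow> Cond a b \<in> cterms"
| "t \<in> cterms \<Longrightarrow> Neg t \<in> cterms"
| "t \<in> cterms \<Longrightarrow> s \<in> cterms \<Longrightarrow> Conj t s \<in> cterms"
| "t \<in> cterms \<Longrightarrow> s \<in> cterms \<Longrightarrow> Disj t s \<in> cterms"

primrec sup_antecedents :: "'a::boolean_algebra cterm \<Rightarrow> 'a" where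
  "sup_antecedents Zero = bot"
| "sup_antecedents One = bot"
| "sup_antecedents (Cond a b) = b"
| "sup_antecedents (Neg t) = sup_antecedents t"
| "sup_antecedents (Conj t s) = sup (sup_antecedents t) (sup_antecedents s)"
| "sup_antecedents (Disj t s) = sup (sup_antecedents t) (sup_antecedents s)"

definition bb :: "'a::boolean_algebra cterm \<Rightarrow> 'a" where
  "bb t = (if t = Zero \<or> t = One then top else sup_antecedents t)"

primrec subst_world :: "('a::boolean_algebra \<Rightarrow> bool) \<Rightarrow> 'a cterm \<Rightarrow> 'a cterm" where
  "subst_world w Zero = Zero"
| "subst_world w One = One"
| "subst_world w (Cond a b) =
     (if w (inf a b) then One else if w (inf (- a) b) then Zero else Cond a b)"
| "subst_world w (Neg t) = Neg (subst_world w t)"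
| "subst_world w (Conj t s) = Conj (subst_world w t) (subst_world w s)"
| "subst_world w (Disj t s) = Disj (subst_world w t) (subst_world w s)"

text \<open>
  The rules may be applied to any subterm. The exhaustive rewriting is computed bottom-up by
  \<open>simplify\<close>; the lemmas below show that its result is the unique normal form.
\<close>

inductive simp_step :: "'a cterm \<Rightarrow> 'a cterm \<Rightarrow> bool" where
  "simp_step (Neg One) Zero"
| "simp_step (Neg Zero) One"
| "simp_step (Conj r One) r"
| "simp_step (Conj One r) r"
| "simp_step (Conj r Zero) Zero"
| "simp_step (Conj Zero r) Zero"
| "simp_step (Disj r One) One"
| "simp_step (Disj One r) One"
| "simp_step (Disj r Zero) r"
| "simp_step (Disj Zero r) r"
| "simp_step t t' \<Longrightarrow> simp_step (Neg t) (Neg t')"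
| "simp_step t t' \<Longrightarrow> simp_step (Conj t s) (Conj t' s)"
| "simp_step s s' \<Longrightarrow> simp_step (Conj t s) (Conj t s')"
| "simp_step t t' \<Longrightarrow> simp_step (Disj t s) (Disj t' s)"
| "simp_step s s' \<Longrightarrow> simp_step (Disj t s) (Disj t s')"

definition neg_simp :: "'a cterm \<Rightarrow> 'a cterm" where
  "neg_simp t = (if t = One then Zero else if t = Zero then One else Neg t)"

definition conj_simp :: "'a cterm \<Rightarrow> 'a cterm \<Rightarrow> 'a cterm" where
  "conj_simp t s =
     (if t = Zero \<or> s = Zero then Zero else if t = One then s else if s = One then t else Conj t s)"

definition disj_simp :: "'a cterm \<Rightarrow> 'a cterm \<Rightarrow> 'a cterm" where
  "disj_simp t s =
     (if t = One \<or> s = One then One else if t = Zero then s else if s = Zero then t else Disj t s)"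

primrec simplify :: "'a cterm \<Rightarrow> 'a cterm" where
  "simplify Zero = Zero"
| "simplify One = One"
| "simplify (Cond a b) = Cond a b"
| "simplify (Neg t) = neg_simp (simplify t)"
| "simplify (Conj t s) = conj_simp (simplify t) (simplify s)"
| "simplify (Disj t s) = disj_simp (simplify t) (simplify s)"

lemmas simp_defs = neg_simp_def conj_simp_def disj_simp_def

inductive_cases simp_step_elims:
  "simp_step Zero r" "simp_step One r" "simp_step (Cond a b) r"
  "simp_step (Neg t) r" "simp_step (Conj t s) r" "simp_step (Disj t s) r"

lemma simp_steps_Neg: "simp_step\<^sup>*\<^sup>* t t' \<Longrightarrow> simp_step\<^sup>*\<^sup>* (Neg t) (Neg t')"
  by (induction rule: rtranclp_induct) (auto intro: rtranclp.rtrancl_into_rtrancl simp_step.intros)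

lemma simp_steps_Conj:
  assumes "simp_step\<^sup>*\<^sup>* t t'" "simp_step\<^sup>*\<^sup>* s s'"
  shows "simp_step\<^sup>*\<^sup>* (Conj t s) (Conj t' s')"
proof -
  have "simp_step\<^sup>*\<^sup>* (Conj t s) (Conj t' s)" using assms(1)
    by (induction rule: rtranclp_induct) (auto intro: rtranclp.rtrancl_into_rtrancl simp_step.intros)
  moreover have "simp_step\<^sup>*\<^sup>* (Conj t' s) (Conj t' s')" using assms(2)
    by (induction rule: rtranclp_induct) (auto intro: rtranclp.rtrancl_into_rtrancl simp_step.intros)
  ultimately show ?thesis by (rule rtranclp_trans)
qed

lemma simp_steps_Disj:
  assumes "simp_step\<^sup>*\<^sup>* t t'" "simp_step\<^sup>*\<^sup>* s s'"
  shows "simp_step\<^sup>*\<^sup>* (Disj t s) (Disj t' s')"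
proof -
  have "simp_step\<^sup>*\<^sup>* (Disj t s) (Disj t' s)" using assms(1)
    by (induction rule: rtranclp_induct) (auto intro: rtranclp.rtrancl_into_rtrancl simp_step.intros)
  moreover have "simp_step\<^sup>*\<^sup>* (Disj t' s) (Disj t' s')" using assms(2)
    by (induction rule: rtranclp_induct) (auto intro: rtranclp.rtrancl_into_rtrancl simp_step.intros)
  ultimately show ?thesis by (rule rtranclp_trans)
qed

lemma simplify_reachable: "simp_step\<^sup>*\<^sup>* t (simplify t)"
proof (induction t)
  case (Neg t)
  have "simp_step\<^sup>*\<^sup>* (Neg u) (neg_simp u)" for u :: "'a cterm"
    by (auto simp: neg_simp_def intro: simp_step.intros)
  then show ?case using simp_steps_Neg[OF Neg] by (simp add: rtranclp_trans)
next
  case (Conj t s)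
  have "simp_step\<^sup>*\<^sup>* (Conj u v) (conj_simp u v)" for u v :: "'a cterm"
    by (auto simp: conj_simp_def intro: simp_step.intros)
  then show ?case using simp_steps_Conj[OF Conj] by (simp add: rtranclp_trans)
next
  case (Disj t s)
  have "simp_step\<^sup>*\<^sup>* (Disj u v) (disj_simp u v)" for u v :: "'a cterm"
    by (auto simp: disj_simp_def intro: simp_step.intros)
  then show ?case using simp_steps_Disj[OF Disj] by (simp add: rtranclp_trans)
qed simp_all

lemma simplify_normal: "\<not> simp_step (simplify t) r"
  by (induction t arbitrary: r) (auto simp: simp_defs split: if_splits elim: simp_step_elims)

lemma simplify_step: "simp_step t s \<Longrightarrow> simplify t = simplify s"
  by (induction rule: simp_step.induct) (auto simp: simp_defs)

lemma simplify_id_if_normal: "(\<And>r. \<not> simp_step t r) \<Longrightarrow> simplify t = t"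
  using simplify_reachable[of t] by (metis converse_rtranclpE)

theorem simplify_iff_normal_form:
  "simplify t = s \<longleftrightarrow> simp_step\<^sup>*\<^sup>* t s \<and> (\<forall>r. \<not> simp_step s r)"
proof -
  have "simplify t = simplify s" if "simp_step\<^sup>*\<^sup>* t s"
    using that by (induction rule: rtranclp_induct) (auto dest: simplify_step)
  then show ?thesis
    using simplify_reachable simplify_normal simplify_id_if_normal by metis
qed

definition reduct :: "('a::boolean_algebra \<Rightarrow> bool) \<Rightarrow> 'a cterm \<Rightarrow> 'a cterm" where
  "reduct w t = simplify (subst_world w t)"

text \<open>
  Values of \<open>P\<close> at the condition \<open>bot\<close> are unconstrained and never used. If \<open>inf b c\<close> is
  \<open>bot\<close>, then \<open>P (inf a b) c\<close> and \<open>P b c\<close> are both 0 and the chain rule has no content.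
\<close>

definition cond_prob :: "('a::boolean_algebra \<Rightarrow> 'a \<Rightarrow> real) \<Rightarrow> bool" where
  "cond_prob P \<longleftrightarrow>
     (\<forall>b. b \<noteq> bot \<longrightarrow>
        (\<forall>a. 0 \<le> P a b \<and> P a b \<le> 1) \<and> P top b = 1
        \<and> (\<forall>a a'. inf a a' = bot \<longrightarrow> P (sup a a') b = P a b + P a' b)
        \<and> P b b = 1)
     \<and> (\<forall>a b c. b \<noteq> bot \<longrightarrow> c \<noteq> bot \<longrightarrow> inf b c \<noteq> bot
          \<longrightarrow> P (inf a b) c = P a (inf b c) * P b c)"

definition prevision ::
    "('a::{finite,boolean_algebra} \<Rightarrow> 'a \<Rightarrow> real) \<Rightarrow> (('a \<Rightarrow> bool) \<Rightarrow> real) \<Rightarrow> 'a \<Rightarrow> real" where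
  "prevision P X b = (\<Sum>w\<in>worlds. X w * P (world_atom w) b)"

text \<open>Number of occurrences of conditionals, for the termination proof below.\<close>

primrec nconds :: "'a cterm \<Rightarrow> nat" where
  "nconds Zero = 0"
| "nconds One = 0"
| "nconds (Cond a b) = 1"
| "nconds (Neg t) = nconds t"
| "nconds (Conj t s) = nconds t + nconds s"
| "nconds (Disj t s) = nconds t + nconds s"

lemma nconds_simplify: "nconds (simplify t) \<le> nconds t"
  by (induction t) (auto simp: simp_defs)

lemma nconds_subst_world: "nconds (subst_world w t) \<le> nconds t"
  by (induction t) auto

lemma nconds_subst_world_less:
  assumes "w \<in> worlds" "w (sup_antecedents t)"
  shows "nconds (subst_world w t) < nconds t"
  using assms(2)
proof (induction t)
  case (Conj t s)
  then show ?case using assms(1) nconds_subst_world[of w t] nconds_subst_world[of w s]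
    by (fastforce simp: worlds_def)
next
  case (Disj t s)
  then show ?case using assms(1) nconds_subst_world[of w t] nconds_subst_world[of w s]
    by (fastforce simp: worlds_def)
qed (use assms(1) in \<open>auto simp: worlds_def\<close>)

lemma nconds_reduct_less:
  assumes "w \<in> worlds" "w (bb t)" "t \<noteq> Zero" "t \<noteq> One"
  shows "nconds (reduct w t) < nconds t"
  using nconds_subst_world_less[of w t] nconds_simplify[of "subst_world w t"] assms
  by (simp add: reduct_def bb_def)

text \<open>
  The defining equation is \<open>X_t(w) = prevision P X_r (bb r)\<close> for \<open>r = reduct w t\<close>. Restricting
  the sum to the worlds satisfying \<open>bb r\<close> makes the recursion well-founded; as \<open>P(w' | bb r) = 0\<close>
  at all other worlds, nothing is lost (see \<open>rq_eq_prevision\<close>).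
\<close>

function rq :: "('a::{finite,boolean_algebra} \<Rightarrow> 'a \<Rightarrow> real) \<Rightarrow> 'a cterm \<Rightarrow> ('a \<Rightarrow> bool) \<Rightarrow> real" where
  "rq P t w =
     (if t = One then 1 else if t = Zero then 0
      else (\<Sum>w' | w' \<in> worlds \<and> w' (bb (reduct w t)).
              rq P (reduct w t) w' * P (world_atom w') (bb (reduct w t))))"
  by pat_completeness auto
termination
proof (relation "measure (\<lambda>(P, t, w). if t = Zero \<or> t = One then 0 else Suc (nconds (reduct w t)))")
  fix P :: "'a \<Rightarrow> 'a \<Rightarrow> real" and t :: "'a cterm" and w w' :: "'a \<Rightarrow> bool"
  assume "t \<noteq> One" "t \<noteq> Zero" and "w' \<in> {w'. w' \<in> worlds \<and> w' (bb (reduct w t))}"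
  then show "((P, reduct w t, w'), (P, t, w))
      \<in> measure (\<lambda>(P, t, w). if t = Zero \<or> t = One then 0 else Suc (nconds (reduct w t)))"
    using nconds_reduct_less[of w' "reduct w t"] by auto
qed simp

declare rq.simps [simp del]

lemma cterms_simplify: "t \<in> cterms \<Longrightarrow> simplify t \<in> cterms"
  by (induction rule: cterms.induct) (auto simp: simp_defs intro: cterms.intros)

lemma cterms_reduct: "t \<in> cterms \<Longrightarrow> reduct w t \<in> cterms"
  unfolding reduct_def
  by (rule cterms_simplify, induction rule: cterms.induct) (auto intro: cterms.intros)

lemma bb_simplify_nonbot:
  assumes "t \<in> cterms" "(bot::'a::boolean_algebra) \<noteq> top"
  shows "bb (simplify t :: 'a cterm) \<noteq> bot"
  using assms by (induction rule: cterms.induct) (auto simp: bb_def simp_defs split: if_splits)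

lemma bb_reduct_nonbot:
  assumes "t \<in> cterms" "(bot::'a::boolean_algebra) \<noteq> top"
  shows "bb (reduct w t :: 'a cterm) \<noteq> bot"
proof -
  have "subst_world w t \<in> cterms"
    using assms(1) by (induction rule: cterms.induct) (auto intro: cterms.intros)
  then show ?thesis using bb_simplify_nonbot assms(2) by (simp add: reduct_def)
qed

lemma world_atom_null:
  fixes P :: "'a::{finite,boolean_algebra} \<Rightarrow> 'a \<Rightarrow> real"
  assumes P: "cond_prob P" and w: "w \<in> worlds" "\<not> w b" and b: "b \<noteq> bot"
  shows "P (world_atom w) b = 0"
proof -
  let ?m = "world_atom w"
  have le: "?m \<le> - b"
    unfolding world_atom_def by (rule Inf_fin.coboundedI) (use w in \<open>auto simp: worlds_def\<close>)
  have add: "P (sup x y) b = P x b + P y b" if "inf x y = bot" for x y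
    using P b that by (simp add: cond_prob_def)
  have nn: "0 \<le> P x b" for x using P b by (simp add: cond_prob_def)
  have "P (sup b (- b)) b = 1" "P b b = 1" using P b by (simp_all add: cond_prob_def)
  then have "P (- b) b = 0" using add[of b "- b"] by simp
  moreover have "sup ?m (inf (- b) (- ?m)) = - b"
    using le by (simp add: sup_inf_distrib1 sup_absorb2)
  moreover have "inf ?m (inf (- b) (- ?m)) = bot"
    by (simp add: inf_left_commute)
  ultimately show ?thesis
    using add[of ?m "inf (- b) (- ?m)"] nn[of ?m] nn[of "inf (- b) (- ?m)"] by simp
qed

lemma rq_One: "rq P One w = 1"
  by (simp add: rq.simps)

lemma rq_Zero: "rq P Zero w = 0"
  by (simp add: rq.simps)

theorem rq_eq_prevision:
  fixes P :: "'a::{finite,boolean_algebra} \<Rightarrow> 'a \<Rightarrow> real"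
  assumes P: "cond_prob P" and t: "t \<in> cterms" "t \<noteq> Zero" "t \<noteq> One" and w: "w \<in> worlds"
  shows "rq P t w = prevision P (rq P (reduct w t)) (bb (reduct w t))"
proof -
  have "(bot::'a) \<noteq> top" using w unfolding worlds_def by force
  then have nb: "bb (reduct w t) \<noteq> bot" using bb_reduct_nonbot t by blast
  show ?thesis
    unfolding prevision_def rq.simps[of P t w] using t
    by (auto intro!: sum.mono_neutral_left intro: ccontr dest: world_atom_null[OF P _ _ nb])
qed

definition cterm_equiv :: "('a::{finite,boolean_algebra} cterm \<times> 'a cterm) set" where
  "cterm_equiv = {(t, s). t \<in> cterms \<and> s \<in> cterms
     \<and> (\<forall>P. cond_prob P \<longrightarrow> (\<forall>w\<in>worlds. rq P t w = rq P s w))}"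

abbreviation cterm_class :: "'a::{finite,boolean_algebra} cterm \<Rightarrow> 'a cterm set" where
  "cterm_class t \<equiv> cterm_equiv `` {t}"

definition class_conj ::
    "'a::{finite,boolean_algebra} cterm set \<Rightarrow> 'a cterm set \<Rightarrow> 'a cterm set" where
  "class_conj C D = (\<Union>t\<in>C. \<Union>s\<in>D. cterm_class (Conj t s))"

definition class_disj ::
    "'a::{finite,boolean_algebra} cterm set \<Rightarrow> 'a cterm set \<Rightarrow> 'a cterm set" where
  "class_disj C D = (\<Union>t\<in>C. \<Union>s\<in>D. cterm_class (Disj t s))"

definition class_neg :: "'a::{finite,boolean_algebra} cterm set \<Rightarrow> 'a cterm set" where
  "class_neg C = (\<Union>t\<in>C. cterm_class (Neg t))"

text \<open>The library locale \<open>abstract_boolean_algebra\<close>, relativised to a carrier set.\<close>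

locale boolean_algebra_on =
  fixes B :: "'b set"
    and conj disj :: "'b \<Rightarrow> 'b \<Rightarrow> 'b"
    and compl :: "'b \<Rightarrow> 'b"
    and zero one :: 'b
  assumes conj_closed: "x \<in> B \<Longrightarrow> y \<in> B \<Longrightarrow> conj x y \<in> B"
    and disj_closed: "x \<in> B \<Longrightarrow> y \<in> B \<Longrightarrow> disj x y \<in> B"
    and compl_closed: "x \<in> B \<Longrightarrow> compl x \<in> B"
    and zero_closed: "zero \<in> B"
    and one_closed: "one \<in> B"
    and conj_assoc: "x \<in> B \<Longrightarrow> y \<in> B \<Longrightarrow> z \<in> B \<Longrightarrow> conj (conj x y) z = conj x (conj y z)"
    and conj_commute: "x \<in> B \<Longrightarrow> y \<in> B \<Longrightarrow> conj x y = conj y x"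
    and disj_assoc: "x \<in> B \<Longrightarrow> y \<in> B \<Longrightarrow> z \<in> B \<Longrightarrow> disj (disj x y) z = disj x (disj y z)"
    and disj_commute: "x \<in> B \<Longrightarrow> y \<in> B \<Longrightarrow> disj x y = disj y x"
    and conj_disj_distrib:
      "x \<in> B \<Longrightarrow> y \<in> B \<Longrightarrow> z \<in> B \<Longrightarrow> conj x (disj y z) = disj (conj x y) (conj x z)"
    and disj_conj_distrib:
      "x \<in> B \<Longrightarrow> y \<in> B \<Longrightarrow> z \<in> B \<Longrightarrow> disj x (conj y z) = conj (disj x y) (disj x z)"
    and conj_one_right: "x \<in> B \<Longrightarrow> conj x one = x"
    and disj_zero_right: "x \<in> B \<Longrightarrow> disj x zero = x"
    and conj_cancel_right: "x \<in> B \<Longrightarrow> conj x (compl x) = zero"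
    and disj_cancel_right: "x \<in> B \<Longrightarrow> disj x (compl x) = one"

end

theory Submission
  imports Defs
begin

text \<open>
  An enumeration of all worlds evaluates every term to a truth value, the conditional \<open>(a | b)\<close>
  being decided by the first world of the enumeration that satisfies \<open>b\<close>. By the chain rule,
  \<open>X_t(w)\<close> is the probability that \<open>t\<close> is true at \<open>w\<close> followed by an enumeration drawn
  without replacement according to \<open>P\<close>, so \<open>X_t\<close> depends only on these truth values.
  Conversely, an enumeration defines a two-valued conditional probability for which \<open>X_t\<close> at its
  first world is the truth value of \<open>t\<close>. Hence \<open>t \<equiv> s\<close> iff \<open>t\<close> and \<open>s\<close> have the same
  truth value at every enumeration, and the Boolean laws are inherited from the truth values.
\<close>

section \<open>Worlds and atoms\<close>

lemma worldsD:
  assumes "w \<in> worlds"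
  shows "\<not> w bot" "w top" "w (inf a b) \<longleftrightarrow> w a \<and> w b" "w (sup a b) \<longleftrightarrow> w a \<or> w b"
    "w (- a) \<longleftrightarrow> \<not> w a"
  using assms by (simp_all add: worlds_def)

lemma world_mono: "w \<in> worlds \<Longrightarrow> a \<le> b \<Longrightarrow> w a \<Longrightarrow> w b"
  by (metis inf.absorb1 worldsD(3))

lemma world_world_atom:
  fixes w :: "'a::{finite,boolean_algebra} \<Rightarrow> bool"
  assumes "w \<in> worlds"
  shows "w (world_atom w)"
proof -
  have "{a. w a} \<noteq> {}" using worldsD(2)[OF assms] by blast
  moreover have "w (Inf_fin A)" if "finite A" "A \<noteq> {}" "A \<subseteq> {a. w a}" for A
    using that by (induction A rule: finite_ne_induct) (simp_all add: worldsD(3)[OF assms])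
  ultimately show ?thesis by (simp add: world_atom_def)
qed

lemma world_atom_le_iff:
  fixes w :: "'a::{finite,boolean_algebra} \<Rightarrow> bool"
  assumes "w \<in> worlds"
  shows "world_atom w \<le> a \<longleftrightarrow> w a"
proof
  show "w a" if "world_atom w \<le> a"
    using that world_mono[OF assms] world_world_atom[OF assms] by blast
  show "world_atom w \<le> a" if "w a"
    unfolding world_atom_def by (rule Inf_fin.coboundedI) (use that in simp_all)
qed

lemma world_at_world_atom_iff:
  fixes w w' :: "'a::{finite,boolean_algebra} \<Rightarrow> bool"
  assumes "w \<in> worlds" "w' \<in> worlds"
  shows "w' (world_atom w) \<longleftrightarrow> w' = w"
proof
  assume *: "w' (world_atom w)"
  have "w a \<Longrightarrow> w' a" for a
    using world_mono[OF assms(2) _ *] world_atom_le_iff[OF assms(1)] by blast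
  then show "w' = w" using worldsD(5)[OF assms(1)] worldsD(5)[OF assms(2)] by blast
qed (use world_world_atom assms in blast)

text \<open>Finiteness gives a minimal nonzero element below \<open>x\<close>. It is an atom, and
  its up-set is a world because an atom lies below exactly one of \<open>a\<close> and
  \<open>- a\<close>.\<close>

lemma world_exists:
  fixes x :: "'a::{finite,boolean_algebra}"
  assumes "x \<noteq> bot"
  obtains w where "w \<in> worlds" "w x"
proof -
  obtain m where m: "m \<noteq> bot" "m \<le> x" "\<And>y. y \<noteq> bot \<Longrightarrow> y \<le> m \<Longrightarrow> y = m"
    using finite_has_minimal2[of "{y. y \<noteq> bot}" x] assms by auto
  have atom: "m \<le> - a \<longleftrightarrow> \<not> m \<le> a" for a
  proof
    show "\<not> m \<le> a" if "m \<le> - a"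
      using that m(1) by (metis inf.absorb_iff1 inf_shunt le_infI order_refl)
    show "m \<le> - a" if "\<not> m \<le> a"
      using that m(3)[of "inf m a"] by (metis inf.cobounded1 inf.cobounded2 inf_shunt)
  qed
  have "m \<le> sup a b \<longleftrightarrow> m \<le> a \<or> m \<le> b" for a b
    using atom[of "sup a b"] atom[of a] atom[of b] by (auto intro: le_supI1 le_supI2)
  then have "(\<le>) m \<in> worlds"
    using m(1) atom by (auto simp: worlds_def bot_unique)
  then show thesis using that m(2) by blast
qed

lemma sup_world_atom_diff:
  fixes w :: "'a::{finite,boolean_algebra} \<Rightarrow> bool"
  assumes "w \<in> worlds" "w c"
  shows "sup (world_atom w) (inf c (- world_atom w)) = c"
  using assms by (simp add: sup_inf_distrib1 sup_absorb2 world_atom_le_iff)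

lemma worlds_of_diff_atom:
  fixes w :: "'a::{finite,boolean_algebra} \<Rightarrow> bool"
  assumes "w \<in> worlds"
  shows "{w' \<in> worlds. w' (inf c (- world_atom w))} = {w' \<in> worlds. w' c} - {w}"
  using assms by (auto simp: worldsD world_at_world_atom_iff)

lemma card_worlds_of_diff_atom_less:
  fixes w :: "'a::{finite,boolean_algebra} \<Rightarrow> bool"
  assumes "w \<in> worlds" "w c"
  shows "card {w' \<in> worlds. w' (inf c (- world_atom w))} < card {w' \<in> worlds. w' c}"
  unfolding worlds_of_diff_atom[OF assms(1)] by (rule card_Diff1_less) (use assms in auto)

lemma cond_prob_sum_atoms:
  fixes P :: "'a::{finite,boolean_algebra} \<Rightarrow> 'a \<Rightarrow> real"
  assumes P: "cond_prob P" and c: "c \<noteq> bot"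
  shows "P a c = (\<Sum>w | w \<in> worlds \<and> w a. P (world_atom w) c)"
proof (induction "card {w \<in> worlds. w a}" arbitrary: a rule: less_induct)
  case less
  have add: "P (sup x y) c = P x c + P y c" if "inf x y = bot" for x y
    using P c that by (simp add: cond_prob_def)
  show ?case
  proof (cases "a = bot")
    case True
    have empty: "{w \<in> worlds. w (bot::'a)} = {}" using worldsD(1) by blast
    \<comment> \<open>Additivity at the disjoint pair \<open>bot\<close>, \<open>bot\<close> forces
      \<open>P bot c = 0\<close>.\<close>
    show ?thesis unfolding True empty using add[of bot bot] by simp
  next
    case False
    then obtain w where w: "w \<in> worlds" "w a" by (rule world_exists)
    let ?a = "inf a (- world_atom w)"
    have "P a c = P (world_atom w) c + P ?a c"
      using add[of "world_atom w" ?a] sup_world_atom_diff[OF w] by (simp add: inf_left_commute)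
    also have "P ?a c = (\<Sum>w' \<in> {w' \<in> worlds. w' a} - {w}. P (world_atom w') c)"
      using less[OF card_worlds_of_diff_atom_less[OF w]] worlds_of_diff_atom[OF w(1)] by simp
    also have "P (world_atom w) c + \<dots> = (\<Sum>w' | w' \<in> worlds \<and> w' a. P (world_atom w') c)"
      using w by (subst sum.remove[of _ w]) auto
    finally show ?thesis .
  qed
qed

lemma cond_prob_self: "cond_prob P \<Longrightarrow> c \<noteq> bot \<Longrightarrow> P c c = 1"
  and cond_prob_top: "cond_prob P \<Longrightarrow> c \<noteq> bot \<Longrightarrow> P top c = 1"
  by (simp_all add: cond_prob_def)

lemma cond_prob_chain:
  assumes "cond_prob P" "b \<noteq> bot" "a \<le> b" "b \<le> c"
  shows "P a c = P a b * P b c"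
proof -
  have "c \<noteq> bot" using assms(2,4) bot_unique by blast
  moreover have "P (inf a b) c = P a (inf b c) * P b c"
    if "b \<noteq> bot" "c \<noteq> bot" "inf b c \<noteq> bot"
    using assms(1) that unfolding cond_prob_def by blast
  ultimately show ?thesis using assms(2-4) by (simp add: inf_absorb1)
qed

section \<open>Truth of a term along a list of worlds\<close>

text \<open>The value for \<open>None\<close> is a default: over a finite algebra, a list of all
  worlds contains one satisfying any given nonzero antecedent.\<close>

primrec holds :: "('a \<Rightarrow> bool) list \<Rightarrow> 'a cterm \<Rightarrow> bool" where
  "holds ws Zero = False"
| "holds ws One = True"
| "holds ws (Cond a b) = (case find (\<lambda>w. w b) ws of None \<Rightarrow> False | Some w \<Rightarrow> w a)"
| "holds ws (Neg t) = (\<not> holds ws t)"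
| "holds ws (Conj t s) = (holds ws t \<and> holds ws s)"
| "holds ws (Disj t s) = (holds ws t \<or> holds ws s)"

lemma holds_simplify [simp]: "holds ws (simplify t) = holds ws t"
  by (induction t) (auto simp: simp_defs)

text \<open>Reducing by \<open>w\<close> settles exactly the conditionals whose antecedent is true
  at \<open>w\<close>, which are those decided by a first entry \<open>w\<close>; the others are
  left to \<open>ws\<close>.\<close>

lemma holds_reduct:
  assumes "w \<in> worlds"
  shows "holds ws (reduct w t) = holds (w # ws) t"
  unfolding reduct_def holds_simplify by (induction t) (auto simp: worldsD[OF assms])

lemma find_stronger:
  assumes "find P ws = Some u" "\<And>w. w \<in> set ws \<Longrightarrow> Q w \<Longrightarrow> P w" "Q u"
  shows "find Q ws = Some u"
  using assms by (induction ws) (auto split: if_splits)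

text \<open>Any entry before the first \<open>u\<close> falsifies \<open>b\<close>, hence every
  antecedent in \<open>t\<close>. So a conditional whose antecedent is true at \<open>u\<close> is
  decided by \<open>u\<close> anyway, and any other one skips the added copy.\<close>

lemma holds_Cons_first:
  assumes "set ws \<subseteq> worlds" "find (\<lambda>w. w b) ws = Some u" "sup_antecedents t \<le> b"
  shows "holds (u # ws) t = holds ws t"
  using assms(3)
proof (induction t)
  case (Cond a b')
  have "find (\<lambda>w. w b') ws = Some u" if "u b'"
    by (rule find_stronger[OF assms(2)]) (use that assms(1) Cond world_mono in auto)
  then show ?case by auto
qed auto

lemma simplify_reduct [simp]: "simplify (reduct w t) = reduct w t"
  unfolding reduct_def by (rule simplify_id_if_normal) (rule simplify_normal)

lemma sup_antecedents_simplify: "sup_antecedents (simplify t) \<le> sup_antecedents t"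
  by (induction t) (simp_all add: simp_defs sup_mono le_supI1 le_supI2)

text \<open>A conditional that survives substitution has an antecedent false at \<open>w\<close>,
  hence disjoint from the atom of \<open>w\<close>; simplification only discards conditionals. This
  is why drawing without replacement suffices.\<close>

lemma sup_antecedents_reduct:
  fixes w :: "'a::{finite,boolean_algebra} \<Rightarrow> bool"
  assumes "w \<in> worlds"
  shows "sup_antecedents (reduct w t) \<le> inf (sup_antecedents t) (- world_atom w)"
proof -
  have "sup_antecedents (subst_world w t) \<le> inf (sup_antecedents t) (- world_atom w)"
  proof (induction t)
    case (Cond a b)
    have "b \<le> - world_atom w" if "\<not> w b"
      using that assms world_atom_le_iff[of w "- b"] worldsD(5)[OF assms]
      by (metis compl_le_swap1)
    then show ?case by (auto simp: worldsD[OF assms])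
  qed (auto intro: le_infI1 le_supI1 le_supI2)
  then show ?thesis unfolding reduct_def using sup_antecedents_simplify order_trans by blast
qed

lemma reduct_outside:
  assumes "w \<in> worlds" "\<not> w (sup_antecedents t)" "simplify t = t"
  shows "reduct w t = t"
proof -
  have "subst_world w t = t"
    using assms(2) by (induction t) (auto simp: worldsD[OF assms(1)])
  then show ?thesis using assms(3) by (simp add: reduct_def)
qed

section \<open>The prevision of a term\<close>

text \<open>The sum is restricted as in the recursion for \<open>rq\<close>, so that the value of a
  term at a world becomes \<open>term_prev\<close> of its reduct.\<close>

definition term_prev :: "('a::{finite,boolean_algebra} \<Rightarrow> 'a \<Rightarrow> real) \<Rightarrow> 'a cterm \<Rightarrow> real" where
  "term_prev P t = (\<Sum>w | w \<in> worlds \<and> w (bb t). rq P t w * P (world_atom w) (bb t))"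

lemma term_prev_Zero [simp]: "term_prev P Zero = 0"
  by (simp add: term_prev_def rq_Zero)

lemma term_prev_One:
  fixes P :: "'a::{finite,boolean_algebra} \<Rightarrow> 'a \<Rightarrow> real"
  assumes "cond_prob P" "(bot::'a) \<noteq> top"
  shows "term_prev P One = 1"
  using cond_prob_sum_atoms[of P top top] cond_prob_top[of P top] assms
  by (simp add: term_prev_def rq_One bb_def)

lemma rq_eq_term_prev:
  fixes P :: "'a::{finite,boolean_algebra} \<Rightarrow> 'a \<Rightarrow> real"
  assumes "cond_prob P" "(bot::'a) \<noteq> top"
  shows "rq P t w = term_prev P (reduct w t)"
proof (cases "t = One \<or> t = Zero")
  case True
  then show ?thesis using term_prev_One[OF assms] by (auto simp: rq_One rq_Zero reduct_def)
next
  case False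
  then show ?thesis by (simp add: rq.simps[of P t] term_prev_def)
qed

text \<open>
  The expectation of \<open>F\<close> over the enumerations of the worlds below \<open>c\<close>, drawn successively
  without replacement, each world according to \<open>P\<close> conditioned on the worlds that remain.
\<close>

function chain_exp ::
    "('a::{finite,boolean_algebra} \<Rightarrow> 'a \<Rightarrow> real) \<Rightarrow> 'a \<Rightarrow> (('a \<Rightarrow> bool) list \<Rightarrow> real) \<Rightarrow> real" where
  "chain_exp P c F =
     (if c = bot then F []
      else (\<Sum>w | w \<in> worlds \<and> w c.
              P (world_atom w) c * chain_exp P (inf c (- world_atom w)) (\<lambda>ws. F (w # ws))))"
  by pat_completeness auto
termination
  by (relation "measure (\<lambda>(P, c, F). card {w \<in> worlds. w c})")
    (auto simp: card_worlds_of_diff_atom_less)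

declare chain_exp.simps [simp del]

text \<open>The recursion stops once every world below \<open>c\<close> has been drawn, so
  \<open>F\<close> is evaluated only at lists of exactly these worlds.\<close>

lemma chain_exp_cong:
  assumes "\<And>ws. set ws = {w \<in> worlds. w c} \<Longrightarrow> F ws = G ws"
  shows "chain_exp P c F = chain_exp P c G"
  using assms
proof (induction "card {w \<in> worlds. w c}" arbitrary: c F G rule: less_induct)
  case less
  show ?case
  proof (cases "c = bot")
    case True
    then show ?thesis using less.prems[of "[]"] by (simp add: chain_exp.simps worldsD(1))
  next
    case False
    have "chain_exp P (inf c (- world_atom w)) (\<lambda>ws. F (w # ws))
        = chain_exp P (inf c (- world_atom w)) (\<lambda>ws. G (w # ws))" if w: "w \<in> worlds" "w c" for w
    proof (rule less.hyps[OF card_worlds_of_diff_atom_less[OF w]])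
      fix ws assume "set ws = {w' \<in> worlds. w' (inf c (- world_atom w))}"
      then have "set (w # ws) = {w \<in> worlds. w c}"
        using w unfolding worlds_of_diff_atom[OF w(1)] by auto
      then show "F (w # ws) = G (w # ws)" by (rule less.prems)
    qed
    then show ?thesis using False by (simp add: chain_exp.simps[of P c])
  qed
qed

text \<open>At each draw the weights of the available worlds add up to
  \<open>P c c = 1\<close>.\<close>

lemma chain_exp_const:
  assumes "cond_prob P"
  shows "chain_exp P c (\<lambda>_. k) = k"
proof (induction "card {w \<in> worlds. w c}" arbitrary: c rule: less_induct)
  case less
  have IH: "chain_exp P (inf c (- world_atom w)) (\<lambda>_. k) = k" if "w \<in> worlds" "w c" for w
    by (rule less) (rule card_worlds_of_diff_atom_less[OF that])
  show ?case
  proof (cases "c = bot")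
    case False
    have "chain_exp P c (\<lambda>_. k) = (\<Sum>w | w \<in> worlds \<and> w c. P (world_atom w) c) * k"
      using False IH by (simp add: chain_exp.simps[of P c] sum_distrib_right)
    then show ?thesis
      using cond_prob_sum_atoms[OF assms False, of c] cond_prob_self[OF assms False] by simp
  qed (simp add: chain_exp.simps)
qed

text \<open>Condition on the first draw, with p = P(b | c) for the join b of the antecedents. The
  draws outside b leave \<open>t\<close> as it is and contribute (1 - p) times its prevision; by the
  chain rule those inside b contribute p times it. Nothing is divided by p, so p = 0 is covered. The
  bound \<open>c\<close> is kept apart from b because the antecedents of a reduct need not cover the
  worlds still to be drawn.\<close>

lemma term_prev_eq_chain_exp:
  fixes P :: "'a::{finite,boolean_algebra} \<Rightarrow> 'a \<Rightarrow> real"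
  assumes P: "cond_prob P" and nt: "(bot::'a) \<noteq> top"
    and "t \<in> cterms" "simplify t = t" "sup_antecedents t \<le> c"
  shows "term_prev P t = chain_exp P c (\<lambda>ws. of_bool (holds ws t))"
  using assms(3-)
proof (induction "card {w \<in> worlds. w c}" arbitrary: c t rule: less_induct)
  case less
  show ?case
  proof (cases "t = Zero \<or> t = One")
    case True
    then show ?thesis using term_prev_One[OF P nt] chain_exp_const[OF P] by auto
  next
    case False
    let ?b = "sup_antecedents t"
    let ?W = "{w \<in> worlds. w c}" and ?V = "{w \<in> worlds. w ?b}"
    let ?p = "\<lambda>w. P (world_atom w) c"
    have bb: "bb t = ?b" using False by (simp add: bb_def)
    then have b: "?b \<noteq> bot" using bb_simplify_nonbot[of t] less.prems nt by simp
    then have c: "c \<noteq> bot" using less.prems(3) bot_unique by auto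
    have VW: "?V \<subseteq> ?W" using world_mono less.prems(3) by blast
    \<comment> \<open>After drawing \<open>w\<close>, the truth of \<open>t\<close> is that of its
      reduct along the remaining draws.\<close>
    have IH: "chain_exp P (inf c (- world_atom w)) (\<lambda>ws. of_bool (holds (w # ws) t))
        = term_prev P (reduct w t)" if w: "w \<in> worlds" "w c" for w
    proof -
      have "term_prev P (reduct w t)
          = chain_exp P (inf c (- world_atom w)) (\<lambda>ws. of_bool (holds ws (reduct w t)))"
      proof (rule less.hyps[OF card_worlds_of_diff_atom_less[OF w]])
        show "reduct w t \<in> cterms" by (rule cterms_reduct) (rule less.prems)
        show "sup_antecedents (reduct w t) \<le> inf c (- world_atom w)"
          using sup_antecedents_reduct[OF w(1), of t] less.prems(3)
          by (meson inf_mono order_refl order_trans)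
      qed simp
      then show ?thesis by (simp add: holds_reduct[OF w(1)])
    qed
    have "chain_exp P c (\<lambda>ws. of_bool (holds ws t)) = (\<Sum>w\<in>?W. ?p w * term_prev P (reduct w t))"
      using c IH by (simp add: chain_exp.simps[of P c])
    also have "\<dots> = (\<Sum>w\<in>?W - ?V. ?p w * term_prev P (reduct w t))
        + (\<Sum>w\<in>?V. ?p w * term_prev P (reduct w t))"
      using VW by (intro sum.subset_diff) auto
    also have "(\<Sum>w\<in>?W - ?V. ?p w * term_prev P (reduct w t)) = (\<Sum>w\<in>?W - ?V. ?p w * term_prev P t)"
      using reduct_outside[OF _ _ less.prems(2)] by (intro sum.cong) auto
    also have "\<dots> = (1 - P ?b c) * term_prev P t"
      using cond_prob_sum_atoms[OF P c, of c] cond_prob_sum_atoms[OF P c, of ?b]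
        cond_prob_self[OF P c] VW
      by (simp add: sum_diff flip: sum_distrib_right)
    also have "(\<Sum>w\<in>?V. ?p w * term_prev P (reduct w t))
        = (\<Sum>w\<in>?V. P ?b c * (rq P t w * P (world_atom w) ?b))"
    proof (intro sum.cong refl)
      fix w assume "w \<in> ?V"
      then have "?p w = P (world_atom w) ?b * P ?b c"
        by (intro cond_prob_chain[OF P b _ less.prems(3)]) (simp add: world_atom_le_iff)
      then show "?p w * term_prev P (reduct w t) = P ?b c * (rq P t w * P (world_atom w) ?b)"
        by (simp only: rq_eq_term_prev[OF P nt] mult_ac)
    qed
    also have "\<dots> = P ?b c * term_prev P t"
      by (simp add: term_prev_def bb sum_distrib_left)
    finally show ?thesis by (simp add: algebra_simps)
  qed
qed

text \<open>The draws start from \<open>top\<close>, so \<open>w\<close> comes up again in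
  \<open>ws\<close>. This is harmless: the entry in front has already decided every antecedent true
  at \<open>w\<close>.\<close>

lemma rq_eq_chain_exp:
  fixes P :: "'a::{finite,boolean_algebra} \<Rightarrow> 'a \<Rightarrow> real"
  assumes "cond_prob P" "(bot::'a) \<noteq> top" "t \<in> cterms" "w \<in> worlds"
  shows "rq P t w = chain_exp P top (\<lambda>ws. of_bool (holds (w # ws) t))"
  using term_prev_eq_chain_exp[OF assms(1,2) cterms_reduct[OF assms(3)], of w top] assms(4)
  by (simp add: rq_eq_term_prev[OF assms(1,2)] holds_reduct)

section \<open>Two-valued conditional probabilities\<close>

text \<open>Given \<open>b\<close>, all mass sits on the first world of the list satisfying
  \<open>b\<close>. For a list of all worlds the default 0 occurs only at
  \<open>b = bot\<close>.\<close>

definition list_prob :: "('a \<Rightarrow> bool) list \<Rightarrow> 'a \<Rightarrow> 'a \<Rightarrow> real" where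
  "list_prob ws a b = (case find (\<lambda>w. w b) ws of None \<Rightarrow> 0 | Some w \<Rightarrow> of_bool (w a))"

lemma find_SomeD: "find P ws = Some u \<Longrightarrow> u \<in> set ws \<and> P u"
  by (auto simp: find_Some_iff)

lemma find_world:
  fixes b :: "'a::{finite,boolean_algebra}"
  assumes "set ws = worlds" "b \<noteq> bot"
  obtains u where "find (\<lambda>w. w b) ws = Some u" "u \<in> worlds" "u b"
proof -
  obtain w where "w \<in> worlds" "w b" using assms(2) by (rule world_exists)
  then have "find (\<lambda>w. w b) ws \<noteq> None" using assms(1) by (auto simp: find_None_iff)
  then obtain u where u: "find (\<lambda>w. w b) ws = Some u" by auto
  show thesis by (rule that[OF u]) (use find_SomeD[OF u] assms(1) in simp_all)
qed

lemma cond_prob_list_prob: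
  fixes ws :: "('a::{finite,boolean_algebra} \<Rightarrow> bool) list"
  assumes ws: "set ws = worlds"
  shows "cond_prob (list_prob ws)"
  unfolding cond_prob_def
proof (intro conjI allI impI)
  fix a b c :: 'a
  assume "c \<noteq> bot" and bc: "inf b c \<noteq> bot"
  then obtain u where u: "find (\<lambda>w. w c) ws = Some u" "u \<in> worlds" "u c"
    using find_world[OF ws] by metis
  \<comment> \<open>If \<open>b\<close> holds at the first world satisfying \<open>c\<close>, this
    world is also the first satisfying \<open>inf b c\<close>; otherwise both sides of the chain
    rule are 0.\<close>
  have "find (\<lambda>w. w (inf b c)) ws = Some u" if "u b"
    by (rule find_stronger[OF u(1)]) (use that u ws in \<open>auto simp: worldsD\<close>)
  then show "list_prob ws (inf a b) c = list_prob ws a (inf b c) * list_prob ws b c"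
    using u by (auto simp: list_prob_def worldsD)
next
  fix b :: 'a assume "b \<noteq> bot"
  then obtain u where u: "find (\<lambda>w. w b) ws = Some u" "u \<in> worlds" "u b"
    using find_world[OF ws] by metis
  show "list_prob ws top b = 1" "list_prob ws b b = 1"
    using u by (simp_all add: list_prob_def worldsD)
  fix a a' :: 'a
  show "0 \<le> list_prob ws a b" "list_prob ws a b \<le> 1" using u by (simp_all add: list_prob_def)
  assume "inf a a' = bot"
  then have "\<not> (u a \<and> u a')" using worldsD(1,3)[OF u(2)] by metis
  then show "list_prob ws (sup a a') b = list_prob ws a b + list_prob ws a' b"
    using u by (auto simp: list_prob_def worldsD)
qed

text \<open>The sum collapses to the first world \<open>u\<close> satisfying \<open>bb t\<close>,
  whose reduct has fewer conditionals. Reducing by \<open>u\<close> amounts to a copy of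
  \<open>u\<close> in front, which does not change the truth value.\<close>

lemma term_prev_list_prob:
  fixes ws :: "('a::{finite,boolean_algebra} \<Rightarrow> bool) list"
  assumes ws: "set ws = worlds" and nt: "(bot::'a) \<noteq> top"
    and "t \<in> cterms" "simplify t = t"
  shows "term_prev (list_prob ws) t = of_bool (holds ws t)"
  using assms(3-)
proof (induction "nconds t" arbitrary: t rule: less_induct)
  case less
  note P = cond_prob_list_prob[OF ws]
  show ?case
  proof (cases "t = Zero \<or> t = One")
    case True
    then show ?thesis using term_prev_One[OF P nt] by auto
  next
    case False
    have "bb t \<noteq> bot" using bb_simplify_nonbot[of t] less.prems nt by simp
    then obtain u where u: "find (\<lambda>w. w (bb t)) ws = Some u" "u \<in> worlds" "u (bb t)"
      using find_world[OF ws] by metis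
    have "term_prev (list_prob ws) t
        = (\<Sum>w | w \<in> worlds \<and> w (bb t). if w = u then rq (list_prob ws) t u else 0)"
      unfolding term_prev_def using u
      by (intro sum.cong) (auto simp: list_prob_def world_at_world_atom_iff)
    also have "\<dots> = term_prev (list_prob ws) (reduct u t)"
      using u by (simp add: rq_eq_term_prev[OF P nt])
    also have "\<dots> = of_bool (holds ws (reduct u t))"
      using less.hyps[of "reduct u t"] nconds_reduct_less[of u t] u False
        cterms_reduct[OF less.prems(1)] by simp
    also have "holds ws (reduct u t) = holds ws t"
      using holds_Cons_first[OF _ u(1), of t] ws False u(2) by (simp add: holds_reduct bb_def)
    finally show ?thesis .
  qed
qed

lemma rq_list_prob:
  fixes ws :: "('a::{finite,boolean_algebra} \<Rightarrow> bool) list"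
  assumes ws: "set (w # ws) = worlds" and nt: "(bot::'a) \<noteq> top" and t: "t \<in> cterms"
  shows "rq (list_prob (w # ws)) t w = of_bool (holds (w # ws) t)"
proof -
  have w: "w \<in> worlds" using ws by auto
  \<comment> \<open>Reducing by \<open>w\<close> puts a second copy of \<open>w\<close> in front; it
    may be dropped since \<open>w\<close> is the first world satisfying \<open>top\<close>.\<close>
  have "find (\<lambda>w. w top) (w # ws) = Some w" using worldsD(2)[OF w] by simp
  then have "holds (w # w # ws) t = holds (w # ws) t"
    by (rule holds_Cons_first[rotated]) (use ws in auto)
  then show ?thesis
    using term_prev_list_prob[OF ws nt cterms_reduct[OF t], of w]
    by (simp add: rq_eq_term_prev[OF cond_prob_list_prob[OF ws] nt] holds_reduct[OF w])
qed

section \<open>The algebra of equivalence classes\<close>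

lemma cterm_equiv_iff_holds:
  assumes nt: "(bot::'a::{finite,boolean_algebra}) \<noteq> top"
  shows "(t, s) \<in> cterm_equiv \<longleftrightarrow> t \<in> cterms \<and> s \<in> cterms
    \<and> (\<forall>ws. set ws = (worlds :: ('a \<Rightarrow> bool) set) \<longrightarrow> holds ws t = holds ws s)"
    (is "_ \<longleftrightarrow> _ \<and> _ \<and> ?same")
proof (cases "t \<in> cterms \<and> s \<in> cterms")
  case ts: True
  have ne: "(worlds :: ('a \<Rightarrow> bool) set) \<noteq> {}" using world_exists[of top] nt by (metis empty_iff)
  have "?same" if "(t, s) \<in> cterm_equiv"
  proof (intro allI impI)
    fix vs :: "('a \<Rightarrow> bool) list" assume vs: "set vs = worlds"
    then obtain w ws where eq: "vs = w # ws" using ne by (cases vs) auto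
    \<comment> \<open>The two-valued probability of \<open>vs\<close>, evaluated at the head of
      \<open>vs\<close>, returns the truth value along \<open>vs\<close>.\<close>
    have "rq (list_prob vs) t w = rq (list_prob vs) s w"
      using that cond_prob_list_prob[OF vs] vs eq by (auto simp: cterm_equiv_def)
    then show "holds vs t = holds vs s"
      using rq_list_prob[of w ws] vs nt ts by (simp add: eq of_bool_eq_iff)
  qed
  moreover have "(t, s) \<in> cterm_equiv" if "?same"
  proof -
    have "rq P t w = rq P s w" if "cond_prob P" "w \<in> worlds" for P :: "'a \<Rightarrow> 'a \<Rightarrow> real" and w
    proof -
      have "chain_exp P top (\<lambda>ws. of_bool (holds (w # ws) t))
          = chain_exp P top (\<lambda>ws. of_bool (holds (w # ws) s))"
      proof (rule chain_exp_cong)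
        fix ws :: "('a \<Rightarrow> bool) list" assume "set ws = {w \<in> worlds. w top}"
        then have "set (w # ws) = worlds" using \<open>w \<in> worlds\<close> worldsD(2) by auto
        then show "of_bool (holds (w # ws) t) = (of_bool (holds (w # ws) s) :: real)"
          using \<open>?same\<close> by simp
      qed
      then show ?thesis using rq_eq_chain_exp that nt ts by metis
    qed
    then show ?thesis using ts by (auto simp: cterm_equiv_def)
  qed
  ultimately show ?thesis using ts by blast
qed (auto simp: cterm_equiv_def)

lemma equiv_cterm_equiv: "equiv cterms cterm_equiv"
  by (rule equivI) (auto simp: cterm_equiv_def refl_on_def sym_on_def trans_on_def)

lemma cterm_class_eq_iff:
  assumes "t \<in> cterms" "s \<in> cterms"
  shows "cterm_class t = cterm_class s \<longleftrightarrow> (t, s) \<in> cterm_equiv"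
  by (rule eq_equiv_class_iff[OF equiv_cterm_equiv assms])

theorem theorem4p5:
  assumes nontrivial: "(bot :: 'a::{finite,boolean_algebra}) \<noteq> top"
  shows "equiv (cterms :: 'a cterm set) cterm_equiv
    \<and> (\<lambda>t s :: 'a cterm. cterm_class (Conj t s)) respects2 cterm_equiv
    \<and> (\<lambda>t s :: 'a cterm. cterm_class (Disj t s)) respects2 cterm_equiv
    \<and> (\<lambda>t :: 'a cterm. cterm_class (Neg t)) respects cterm_equiv
    \<and> (\<forall>t \<in> (cterms :: 'a cterm set). \<forall>s \<in> cterms.
          class_conj (cterm_class t) (cterm_class s) = cterm_class (Conj t s)
        \<and> class_disj (cterm_class t) (cterm_class s) = cterm_class (Disj t s)
        \<and> class_neg (cterm_class t) = cterm_class (Neg t))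
    \<and> boolean_algebra_on ((cterms :: 'a cterm set) // cterm_equiv)
        class_conj class_disj class_neg
        (cterm_class (Cond bot top)) (cterm_class (Cond top top))"
proof -
  note equiv = equiv_cterm_equiv[where 'a = 'a] and iff = cterm_equiv_iff_holds[OF nontrivial]
  note intros = cterms.intros
  have class_eqI: "cterm_class t = cterm_class s"
    if "t \<in> cterms" "s \<in> cterms" "\<And>ws. set ws = worlds \<Longrightarrow> holds ws t = holds ws s"
    for t s :: "'a cterm"
    using that by (simp add: cterm_class_eq_iff iff)
  have resp_conj: "(\<lambda>t s :: 'a cterm. cterm_class (Conj t s)) respects2 cterm_equiv"
    by (rule congruent2I') (intro class_eqI intros; simp add: iff)
  have resp_disj: "(\<lambda>t s :: 'a cterm. cterm_class (Disj t s)) respects2 cterm_equiv"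
    by (rule congruent2I') (intro class_eqI intros; simp add: iff)
  have resp_neg: "(\<lambda>t :: 'a cterm. cterm_class (Neg t)) respects cterm_equiv"
    by (rule congruentI) (intro class_eqI intros; simp add: iff)
  have conj: "class_conj (cterm_class t) (cterm_class s) = cterm_class (Conj t s)"
    and disj: "class_disj (cterm_class t) (cterm_class s) = cterm_class (Disj t s)"
    if "t \<in> cterms" "s \<in> cterms" for t s :: "'a cterm"
    using UN_equiv_class2[OF equiv equiv resp_conj that] UN_equiv_class2[OF equiv equiv resp_disj that]
    by (simp_all add: class_conj_def class_disj_def)
  have neg: "class_neg (cterm_class t) = cterm_class (Neg t)" if "t \<in> cterms" for t :: "'a cterm"
    using UN_equiv_class[OF equiv resp_neg that] by (simp add: class_neg_def)
  have bot_top: "\<not> holds ws (Cond bot top)" "holds ws (Cond top top)" if "set ws = worlds"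
    for ws :: "('a \<Rightarrow> bool) list"
    using find_world[OF that, of top] nontrivial worldsD(1) by (metis holds.simps(3) option.case(2))+
  \<comment> \<open>Nontriviality makes \<open>top\<close> a legitimate antecedent.\<close>
  have const: "Cond bot top \<in> (cterms :: 'a cterm set)" "Cond top top \<in> (cterms :: 'a cterm set)"
    using nontrivial[symmetric] by (auto intro: intros)
  have "boolean_algebra_on ((cterms :: 'a cterm set) // cterm_equiv)
      class_conj class_disj class_neg
      (cterm_class (Cond bot top)) (cterm_class (Cond top top))"
    \<comment> \<open>Once representatives are chosen and the operations are pushed into the
      classes, closure is membership in the quotient and each law is a propositional tautology about
      \<open>holds\<close>.\<close>
    by (rule boolean_algebra_on.intro; (elim quotientE; hypsubst)?;
        (simp only: conj disj neg intros const)?; (rule quotientI class_eqI)?;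
        (simp only: intros const)?; (simp only: holds.simps(4-6) bot_top)?; blast)
  then show ?thesis using equiv resp_conj resp_disj resp_neg conj disj neg by blast
qed

end
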